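(* Let $X$ be a real Hilbert space, let $m\in\{2,3,\dots\}$, and let $A_1,\dots,A_m: X\rightrightarrows X$ be maximally monotone operators with resolvents $J_1,\dots,J_m$. Let $\mathbf z\in\mathbf X=X^m$ be a cycle. Then $$\mathbf z=\mathbf J_{\mathbf A}(\mathbf R\mathbf z),$$ and solving this equation (for $\mathbf z\in\mathbf X$) is equivalent to solving $$0\in\mathbf A(\mathbf z)+(\mathbf{Id}-\mathbf R)(\mathbf z).$$
   Context: $\mathbf X=X^m$ is the Hilbert product space. $J_i=(\mathrm{Id}+A_i)^{-1}$ is the resolvent of $A_i$. $\mathbf A=A_1\times\cdots\times A_m$, with resolvent $\mathbf J_{\mathbf A}:\mathbf X\to\mathbf X:(x_1,\dots,x_m)\mapsto(J_1x_1,\dots,J_mx_m)$. $\mathbf R:\mathbf X\to\mathbf X:(x_1,\dots,x_m)\mapsto(x_m,x_1,\dots,x_{m-1})$ is the circular right-shift operator and $\mathbf{Id}$ is the identity on $\mathbf X$. Let $F_1:=\operatorname{Fix}(J_1J_mJ_{m-1}\cdots J_2)$, where $\operatorname{Fix}S=\{x\mid x=Sx\}$. A tuple $\mathbf z=(z_1,\dots,z_m)\in\mathbf X$ is called a cycle if $z_1\in F_1$, $z_2=J_2z_1$, $z_3=J_3z_2$, ..., $z_m=J_mz_{m-1}$. *)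

theory Defs
  imports "HOL-Analysis.Analysis" "HOL-Library.Set_Algebras"
begin

text \<open>
  A set-valued operator on \<open>X\<close> is a function \<open>'a \<Rightarrow> 'a set\<close>, a real Hilbert space is a type of
  class \<open>real_inner\<close> and \<open>complete_space\<close>. Sums of sets are Minkowski sums.
\<close>

definition monotone_operator :: "('a::real_inner \<Rightarrow> 'a set) \<Rightarrow> bool" where
  "monotone_operator A \<longleftrightarrow>
    (\<forall>x y. \<forall>u\<in>A x. \<forall>v\<in>A y. 0 \<le> inner (x - y) (u - v))"

definition maximally_monotone :: "('a::real_inner \<Rightarrow> 'a set) \<Rightarrow> bool" where
  "maximally_monotone A \<longleftrightarrow> monotone_operator A \<and>
    (\<forall>B. monotone_operator B \<and> (\<forall>x. A x \<subseteq> B x) \<longrightarrow> B = A)"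

definition operator_inverse :: "('a \<Rightarrow> 'b set) \<Rightarrow> 'b \<Rightarrow> 'a set" where
  "operator_inverse A u = {x. u \<in> A x}"

text \<open>
  The resolvent is the point-valued form of \<open>(Id + A)\<^sup>-\<^sup>1\<close>. For maximally monotone \<open>A\<close> on
  a Hilbert space the inverse is single-valued with full domain (Minty), so that the definite
  description is meaningful at every point.
\<close>

definition resolvent :: "('a::real_inner \<Rightarrow> 'a set) \<Rightarrow> 'a \<Rightarrow> 'a" where
  "resolvent A u = (THE x. x \<in> operator_inverse (\<lambda>y. {y} + A y) u)"

definition Fix :: "('a \<Rightarrow> 'a) \<Rightarrow> 'a set" where
  "Fix S = {x. x = S x}"

text \<open>
  The Hilbert product space \<open>X\<^sup>m\<close> is the type \<open>'a ^ 'n\<close>, whose index type is enumerated as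
  \<open>e 1, \<dots>, e m\<close> by a bijection \<open>e\<close> from \<open>{1..m}\<close>: the \<open>i\<close>-th component of \<open>x\<close> is \<open>x $ e i\<close>,
  and \<open>tuple e m f\<close> is \<open>(f 1, \<dots>, f m)\<close>.
\<close>

definition tuple :: "(nat \<Rightarrow> 'n::finite) \<Rightarrow> nat \<Rightarrow> (nat \<Rightarrow> 'a) \<Rightarrow> 'a ^ 'n" where
  "tuple e m f = (\<chi> k. f (the_inv_into {1..m} e k))"

definition product_operator ::
    "(nat \<Rightarrow> 'n::finite) \<Rightarrow> nat \<Rightarrow> (nat \<Rightarrow> 'a \<Rightarrow> 'a set) \<Rightarrow> 'a ^ 'n \<Rightarrow> ('a ^ 'n) set" where
  "product_operator e m A x = {u. \<forall>i\<in>{1..m}. u $ e i \<in> A i (x $ e i)}"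

definition product_resolvent ::
    "(nat \<Rightarrow> 'n::finite) \<Rightarrow> nat \<Rightarrow> (nat \<Rightarrow> 'a::real_inner \<Rightarrow> 'a set) \<Rightarrow> 'a ^ 'n \<Rightarrow> 'a ^ 'n" where
  "product_resolvent e m A x = tuple e m (\<lambda>i. resolvent (A i) (x $ e i))"

definition right_shift :: "(nat \<Rightarrow> 'n::finite) \<Rightarrow> nat \<Rightarrow> 'a ^ 'n \<Rightarrow> 'a ^ 'n" where
  "right_shift e m x = tuple e m (\<lambda>i. if i = 1 then x $ e m else x $ e (i - 1))"

text \<open>The fixed point set of \<open>J\<^sub>1 \<circ> J\<^sub>m \<circ> J\<^sub>m\<^sub>-\<^sub>1 \<circ> \<dots> \<circ> J\<^sub>2\<close>.\<close>

definition F1 :: "nat \<Rightarrow> (nat \<Rightarrow> 'a::real_inner \<Rightarrow> 'a set) \<Rightarrow> 'a set" where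
  "F1 m A = Fix (foldr (\<circ>) (map (\<lambda>i. resolvent (A i)) (1 # rev [2..<Suc m])) id)"

definition is_cycle ::
    "(nat \<Rightarrow> 'n::finite) \<Rightarrow> nat \<Rightarrow> (nat \<Rightarrow> 'a::real_inner \<Rightarrow> 'a set) \<Rightarrow> 'a ^ 'n \<Rightarrow> bool" where
  "is_cycle e m A z \<longleftrightarrow> z $ e 1 \<in> F1 m A \<and>
    (\<forall>i\<in>{2..m}. z $ e i = resolvent (A i) (z $ e (i - 1)))"

end

theory Submission
  imports Defs
begin

text \<open>
  Everything reduces to the equivalence \<open>x = J u \<longleftrightarrow> u - x \<in> A x\<close> for a maximally monotone
  operator \<open>A\<close> with resolvent \<open>J\<close>. Read componentwise with \<open>u\<close> a component of the shifted
  tuple, its left-hand side is the fixed point equation and its right-hand side is the inclusion.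
  A cycle satisfies the fixed point equation in all components but the first by the recursion
  that defines it, and unrolling this recursion turns the fixed point condition on \<open>z\<^sub>1\<close> into
  the remaining equation \<open>z\<^sub>1 = J\<^sub>1 z\<^sub>m\<close>.

  The equivalence says that \<open>Id + A\<close> is injective, which is immediate from monotonicity, and
  onto, which is Minty's theorem. The proof of Minty's theorem given here goes through the
  Fitzpatrick function
  \<open>F (x, v) = (SUP (a, b) \<in> gra A. x \<bullet> b + a \<bullet> v - a \<bullet> b)\<close>,
  which lies above the duality product \<open>x \<bullet> v\<close> everywhere, by maximality, and agrees with it on
  the graph, by monotonicity. The function \<open>F + \<parallel>\<cdot>\<parallel>\<^sup>2 / 2\<close> on \<open>X \<times> X\<close> is strongly convex and lower
  semicontinuous, so completeness alone, without weak compactness, provides a minimizer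
  \<open>(x, v)\<close>. The quadratic growth of the function away from its minimizer shows that
  \<open>(-v, -x)\<close> is monotonically related to the graph, hence belongs to it, and then
  that \<open>v = -x\<close>. So \<open>(x, -x)\<close> lies on the graph, that is, \<open>0 \<in> x + A x\<close>. A translation
  of the graph gives every other right-hand side.
\<close>

section \<open>Minimizing strongly convex functions\<close>

lemma convex_combination_norm_sq:
  fixes v w :: "'a::real_inner"
  shows "(norm ((1 - s) *\<^sub>R v + s *\<^sub>R w))\<^sup>2 =
    (1 - s) * (norm v)\<^sup>2 + s * (norm w)\<^sup>2 - s * (1 - s) * (norm (w - v))\<^sup>2"
  by (simp add: power2_norm_eq_inner inner_add_left inner_add_right inner_diff_left
      inner_diff_right inner_commute algebra_simps)

text \<open>
  The set \<open>E\<close> plays the role of the epigraph of a lower semicontinuous convex function \<open>f\<close>,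
  which may take the value \<open>\<infinity>\<close>; the lemma provides the minimizer of \<open>f + \<parallel>\<cdot>\<parallel>\<^sup>2 / 2\<close> together with
  the quadratic growth around it. A minimizing sequence is Cauchy because the value at
  the midpoint of two points undercuts the average value by an eighth of their squared distance.
\<close>

lemma strongly_convex_minimizer:
  fixes E :: "('a::{real_inner, complete_space} \<times> real) set"
  assumes closed: "closed E" and convex: "convex E" and nonempty: "E \<noteq> {}"
    and bdd: "\<And>w t. (w, t) \<in> E \<Longrightarrow> l \<le> t + (norm w)\<^sup>2 / 2"
  obtains w0 t0 where "(w0, t0) \<in> E"
    and "\<And>w t. (w, t) \<in> E \<Longrightarrow>
      t0 + (norm w0)\<^sup>2 / 2 + (norm (w - w0))\<^sup>2 / 2 \<le> t + (norm w)\<^sup>2 / 2"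
proof -
  define val :: "'a \<times> real \<Rightarrow> real" where "val p = snd p + (norm (fst p))\<^sup>2 / 2" for p
  define \<mu> where "\<mu> = Inf (val ` E)"
  have bddb: "bdd_below (val ` E)"
  proof (rule bdd_belowI2)
    fix p
    assume "p \<in> E"
    then show "l \<le> val p"
      using bdd[of "fst p" "snd p"] by (simp add: val_def)
  qed
  have lower: "\<mu> \<le> val p" if "p \<in> E" for p
    unfolding \<mu>_def using bddb that by (simp add: cINF_lower)
  have "\<exists>p\<in>E. val p < \<mu> + inverse (real (Suc n))" for n
    using cInf_lessD[of "val ` E" "\<mu> + inverse (real (Suc n))"] nonempty
    by (auto simp: \<mu>_def)
  then obtain p where pE: "\<And>n. p n \<in> E" and p_val: "\<And>n. val (p n) < \<mu> + inverse (real (Suc n))"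
    by metis
  have conv_comb: "val ((1 - s) *\<^sub>R q + s *\<^sub>R r) =
      (1 - s) * val q + s * val r - s * (1 - s) * (norm (fst r - fst q))\<^sup>2 / 2" for s q r
    unfolding val_def fst_add fst_scaleR snd_add snd_scaleR convex_combination_norm_sq
    by (simp add: field_simps)
  have comb_in: "(1 - s) *\<^sub>R q + s *\<^sub>R r \<in> E" if "q \<in> E" "r \<in> E" "0 \<le> s" "s \<le> 1" for s q r
    using convexD[OF convex that(1,2), of "1 - s" s] that by simp
  have dist_bound: "(norm (fst r - fst q))\<^sup>2 \<le> 4 * (val q + val r - 2 * \<mu>)"
    if "q \<in> E" "r \<in> E" for q r
    using lower[OF comb_in[OF that, of "1/2"]] conv_comb[of "1/2" q r] by simp
  have "Cauchy (\<lambda>n. fst (p n))"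
  proof (rule metric_CauchyI)
    fix \<epsilon> :: real
    assume "0 < \<epsilon>"
    obtain N where N: "8 / \<epsilon>\<^sup>2 < real N"
      using reals_Archimedean2 by blast
    have tail: "8 * (val (p n) - \<mu>) < \<epsilon>\<^sup>2" if "N \<le> n" for n
    proof -
      have "8 / \<epsilon>\<^sup>2 < real (Suc n)"
        using N that by linarith
      then have "8 * inverse (real (Suc n)) < \<epsilon>\<^sup>2"
        using \<open>0 < \<epsilon>\<close> by (simp add: field_simps)
      then show ?thesis
        using p_val[of n] by argo
    qed
    have "dist (fst (p i)) (fst (p j)) < \<epsilon>" if "N \<le> i" "N \<le> j" for i j
    proof -
      have "(norm (fst (p i) - fst (p j)))\<^sup>2 < \<epsilon>\<^sup>2"
        using dist_bound[OF pE[of j] pE[of i]] tail[OF that(1)] tail[OF that(2)]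
        by argo
      then show ?thesis
        using \<open>0 < \<epsilon>\<close> by (simp add: dist_norm power2_less_imp_less)
    qed
    then show "\<exists>N. \<forall>i\<ge>N. \<forall>j\<ge>N. dist (fst (p i)) (fst (p j)) < \<epsilon>"
      by blast
  qed
  then obtain w0 where w0: "(\<lambda>n. fst (p n)) \<longlonglongrightarrow> w0"
    using Cauchy_convergent convergent_def by blast
  have "(\<lambda>n. val (p n)) \<longlonglongrightarrow> \<mu>"
  proof (rule tendsto_sandwich)
    show "\<forall>\<^sub>F n in sequentially. \<mu> \<le> val (p n)"
      using lower pE by simp
    show "\<forall>\<^sub>F n in sequentially. val (p n) \<le> \<mu> + inverse (real (Suc n))"
      using p_val by (simp add: less_imp_le)
    show "(\<lambda>n. \<mu> + inverse (real (Suc n))) \<longlonglongrightarrow> \<mu>"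
      using tendsto_add[OF tendsto_const[of \<mu>] LIMSEQ_inverse_real_of_nat]
      by simp
  qed simp
  \<comment> \<open>The values and the first components converge, hence so do the second components.\<close>
  then have "(\<lambda>n. val (p n) - (norm (fst (p n)))\<^sup>2 / 2) \<longlonglongrightarrow> \<mu> - (norm w0)\<^sup>2 / 2"
    using w0 by (intro tendsto_intros) auto
  then have "(\<lambda>n. snd (p n)) \<longlonglongrightarrow> \<mu> - (norm w0)\<^sup>2 / 2"
    by (simp add: val_def)
  then have "(\<lambda>n. (fst (p n), snd (p n))) \<longlonglongrightarrow> (w0, \<mu> - (norm w0)\<^sup>2 / 2)"
    using w0 by (intro tendsto_Pair)
  then have p0: "(w0, \<mu> - (norm w0)\<^sup>2 / 2) \<in> E"
    using closed_sequentially[OF closed pE] by simp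
  moreover have "\<mu> + (norm (w - w0))\<^sup>2 / 2 \<le> t + (norm w)\<^sup>2 / 2" if wt: "(w, t) \<in> E" for w t
  proof -
    define gap where "gap = t + (norm w)\<^sup>2 / 2 - \<mu>"
    define D where "D = (norm (w - w0))\<^sup>2 / 2"
    \<comment> \<open>Minimality along the segment towards \<open>(w, t)\<close>, divided by the step length \<open>s\<close>.\<close>
    have step: "(1 - s) * D \<le> gap" if s: "0 < s" "s < 1" for s
    proof -
      let ?p0 = "(w0, \<mu> - (norm w0)\<^sup>2 / 2)"
      have "\<mu> \<le> (1 - s) * val ?p0 + s * val (w, t) - s * (1 - s) * (norm (w - w0))\<^sup>2 / 2"
        using lower[OF comb_in[OF p0 wt, of s]] conv_comb[of s ?p0 "(w, t)"] s by simp
      then have "s * ((1 - s) * D) \<le> s * gap"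
        by (simp add: val_def gap_def D_def algebra_simps)
      then show ?thesis
        using s by simp
    qed
    have "((\<lambda>s. (1 - s) * D) \<longlongrightarrow> (1 - 0) * D) (at_right 0)"
      by (intro tendsto_intros)
    moreover have "\<forall>\<^sub>F s in at_right 0. (1 - s) * D \<le> gap"
      using step by (auto simp: eventually_at_right_field intro: exI[of _ 1])
    ultimately have "(1 - 0) * D \<le> gap"
      by (rule tendsto_upperbound) simp
    then show ?thesis
      by (simp add: gap_def D_def)
  qed
  ultimately show ?thesis
    using that[of w0 "\<mu> - (norm w0)\<^sup>2 / 2"] by simp
qed

section \<open>Minty's theorem\<close>

text \<open>
  Surjectivity at the right-hand side \<open>0\<close>, for an operator given by its graph. The epigraph of the
  Fitzpatrick function of \<open>G\<close> is an intersection of closed half-spaces, so the preceding lemma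
  applies to it.
\<close>

lemma maximal_monotone_graph_meets_antidiagonal:
  fixes G :: "('a::{real_inner, complete_space} \<times> 'a) set"
  assumes mono: "\<And>a b x y. (a, b) \<in> G \<Longrightarrow> (x, y) \<in> G \<Longrightarrow> 0 \<le> (x - a) \<bullet> (y - b)"
    and maximal: "\<And>x y. (\<And>a b. (a, b) \<in> G \<Longrightarrow> 0 \<le> (x - a) \<bullet> (y - b)) \<Longrightarrow> (x, y) \<in> G"
  shows "\<exists>x. (x, - x) \<in> G"
proof -
  define E :: "(('a \<times> 'a) \<times> real) set" where
    "E = (\<Inter>(a, b)\<in>G. {p. (b, a) \<bullet> fst p - a \<bullet> b \<le> snd p})"
  have E_iff: "((x, v), t) \<in> E \<longleftrightarrow> (\<forall>(a, b)\<in>G. b \<bullet> x + a \<bullet> v - a \<bullet> b \<le> t)" for x v t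
    by (auto simp: E_def inner_prod_def)
  have "closed E"
    unfolding E_def by (auto intro!: closed_INT closed_Collect_le continuous_intros)
  moreover have "convex E"
  proof (rule convexI)
    fix p q :: "('a \<times> 'a) \<times> real" and r s :: real
    assume p: "p \<in> E" and q: "q \<in> E" and r: "0 \<le> r" and s: "0 \<le> s" and rs: "r + s = 1"
    have "(b, a) \<bullet> fst (r *\<^sub>R p + s *\<^sub>R q) - a \<bullet> b \<le> snd (r *\<^sub>R p + s *\<^sub>R q)" if "(a, b) \<in> G" for a b
    proof -
      have "r * ((b, a) \<bullet> fst p - a \<bullet> b) + s * ((b, a) \<bullet> fst q - a \<bullet> b) \<le> r * snd p + s * snd q"
        using that p q r s by (intro add_mono mult_left_mono) (auto simp: E_def)
      moreover have "r * (a \<bullet> b) + s * (a \<bullet> b) = a \<bullet> b"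
        using rs by (metis distrib_right mult_1)
      ultimately show ?thesis
        by (simp add: inner_add_right right_diff_distrib del: inner_Pair)
    qed
    then show "r *\<^sub>R p + s *\<^sub>R q \<in> E"
      by (auto simp: E_def)
  qed
  \<comment> \<open>The Fitzpatrick function is at most the duality product on the graph.\<close>
  moreover have graph_E: "((a, b), a \<bullet> b) \<in> E" if "(a, b) \<in> G" for a b
    unfolding E_iff using mono[OF _ that]
    by (force simp: inner_diff_left inner_diff_right inner_commute)
  moreover have "G \<noteq> {}"
    using maximal by fastforce
  then have "E \<noteq> {}"
    using graph_E by fastforce
  \<comment> \<open>The Fitzpatrick function majorizes the duality product.\<close>
  moreover have major: "x \<bullet> v \<le> t" if E: "((x, v), t) \<in> E" for x v t
  proof (cases "(x, v) \<in> G")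
    case True
    then show ?thesis
      using E by (force simp: E_iff inner_commute)
  next
    case False
    then obtain a b where "(a, b) \<in> G" and "(x - a) \<bullet> (v - b) < 0"
      using maximal[of x v] by force
    moreover from this E have "b \<bullet> x + a \<bullet> v - a \<bullet> b \<le> t"
      by (auto simp: E_iff)
    ultimately show ?thesis
      by (simp add: inner_diff_left inner_diff_right inner_commute)
  qed
  have norm_pair: "(norm (x, v))\<^sup>2 = x \<bullet> x + v \<bullet> v" for x v :: 'a
    by (simp add: power2_norm_eq_inner inner_prod_def)
  have sum_sq: "(x + v) \<bullet> (x + v) = x \<bullet> x + v \<bullet> v + 2 * (x \<bullet> v)" for x v :: 'a
    by (simp add: inner_add_left inner_add_right inner_commute)
  have "0 \<le> t + (norm w)\<^sup>2 / 2" if wt: "(w, t) \<in> E" for w t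
  proof (cases w)
    case (Pair x v)
    then have "x \<bullet> v \<le> t"
      using major wt by simp
    moreover have "0 \<le> x \<bullet> x + v \<bullet> v + 2 * (x \<bullet> v)"
      by (metis sum_sq inner_ge_zero)
    ultimately have "0 \<le> 2 * t + (x \<bullet> x + v \<bullet> v)"
      by linarith
    then show ?thesis
      by (simp add: Pair norm_pair field_simps)
  qed
  ultimately obtain w0 t0 where w0E: "(w0, t0) \<in> E" and
    growth: "\<And>w t. (w, t) \<in> E \<Longrightarrow>
      t0 + (norm w0)\<^sup>2 / 2 + (norm (w - w0))\<^sup>2 / 2 \<le> t + (norm w)\<^sup>2 / 2"
    using strongly_convex_minimizer[of E 0] by blast
  obtain x v where w0: "w0 = (x, v)"
    by (cases w0)
  \<comment> \<open>Quadratic growth at points of the graph, after bounding \<open>t0\<close> below by \<open>x \<bullet> v\<close>.\<close>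
  have key: "(x + v) \<bullet> (x + v) \<le> (- v - a) \<bullet> (- x - b)" if ab: "(a, b) \<in> G" for a b
    using growth[OF graph_E[OF ab]] major[of x v t0] w0E
    by (simp add: w0 norm_pair inner_diff_left inner_diff_right inner_add_left inner_add_right
        inner_commute field_simps)
  have "0 \<le> (- v - a) \<bullet> (- x - b)" if "(a, b) \<in> G" for a b
    using key[OF that] inner_ge_zero[of "x + v"] by linarith
  then have on_graph: "(- v, - x) \<in> G"
    using maximal by blast
  from key[OF on_graph] have "x + v = 0"
    by (metis diff_self inner_gt_zero_iff inner_zero_left not_less)
  then have "- v = x"
    by (metis eq_neg_iff_add_eq_0)
  with on_graph show ?thesis
    by auto
qed

text \<open>
  A pair that is monotonically related to the whole graph can be added to the graph without
  destroying monotonicity, so maximality forces it to be on the graph already.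
\<close>

lemma maximally_monotone_memI:
  assumes A: "maximally_monotone A"
    and related: "\<And>a b. b \<in> A a \<Longrightarrow> 0 \<le> (x - a) \<bullet> (y - b)"
  shows "y \<in> A x"
proof -
  define B where "B = A(x := insert y (A x))"
  have A_mono: "0 \<le> (a - a') \<bullet> (b - b')" if "b \<in> A a" "b' \<in> A a'" for a a' b b'
    using A that by (auto simp: maximally_monotone_def monotone_operator_def)
  have related': "0 \<le> (a - x) \<bullet> (b - y)" if "b \<in> A a" for a b
    using related[OF that] by (simp add: inner_diff_left inner_diff_right)
  have "monotone_operator B"
    unfolding monotone_operator_def B_def
    using A_mono related related' by (auto split: if_splits)
  then have "B = A"
    using A by (auto simp: maximally_monotone_def B_def)
  then show ?thesis
    by (metis B_def fun_upd_same insertI1)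
qed

theorem minty_surjective:
  fixes A :: "'a::{real_inner, complete_space} \<Rightarrow> 'a set"
  assumes A: "maximally_monotone A"
  shows "\<exists>x. u - x \<in> A x"
proof -
  let ?G = "{(x, y). y + u \<in> A x}"
  have "\<exists>x. (x, - x) \<in> ?G"
  proof (rule maximal_monotone_graph_meets_antidiagonal)
    fix a b x y
    assume "(a, b) \<in> ?G" "(x, y) \<in> ?G"
    then have "0 \<le> (x - a) \<bullet> ((y + u) - (b + u))"
      using A unfolding maximally_monotone_def monotone_operator_def by blast
    then show "0 \<le> (x - a) \<bullet> (y - b)"
      by simp
  next
    fix x y
    assume related: "\<And>a b. (a, b) \<in> ?G \<Longrightarrow> 0 \<le> (x - a) \<bullet> (y - b)"
    have "y + u \<in> A x"
    proof (rule maximally_monotone_memI[OF A])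
      fix a b
      assume "b \<in> A a"
      then show "0 \<le> (x - a) \<bullet> (y + u - b)"
        using related[of a "b - u"] by (simp add: algebra_simps)
    qed
    then show "(x, y) \<in> ?G"
      by simp
  qed
  then show ?thesis
    by auto
qed

lemma eq_resolvent_iff:
  fixes A :: "'a::{real_inner, complete_space} \<Rightarrow> 'a set"
  assumes A: "maximally_monotone A"
  shows "x = resolvent A u \<longleftrightarrow> u - x \<in> A x"
proof -
  have inverse_iff: "y \<in> operator_inverse (\<lambda>y. {y} + A y) u \<longleftrightarrow> u - y \<in> A y" for y
    by (auto simp: operator_inverse_def set_plus_def algebra_simps)
      (metis add_diff_cancel_left' diff_add_cancel add.commute)
  have unique: "y = y'" if "u - y \<in> A y" "u - y' \<in> A y'" for y y'
  proof -
    have "0 \<le> (y - y') \<bullet> ((u - y) - (u - y'))"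
      using A that unfolding maximally_monotone_def monotone_operator_def by blast
    also have "\<dots> = - ((y - y') \<bullet> (y - y'))"
      by (simp add: inner_diff_right)
    finally have "\<not> 0 < (y - y') \<bullet> (y - y')"
      by linarith
    then show ?thesis
      by (metis inner_gt_zero_iff right_minus_eq)
  qed
  have "\<exists>!y. u - y \<in> A y"
    using minty_surjective[OF A] unique by blast
  from theI'[OF this] have "u - resolvent A u \<in> A (resolvent A u)"
    unfolding resolvent_def inverse_iff .
  then show ?thesis
    using unique by blast
qed

section \<open>Cycles\<close>

lemma tuple_nth:
  assumes "bij_betw e {1..m} UNIV" "i \<in> {1..m}"
  shows "tuple e m f $ e i = f i"
  using assms by (simp add: tuple_def the_inv_into_f_f bij_betw_def)

lemma vec_eq_iff_enumerated:
  assumes "bij_betw e {1..m} UNIV"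
  shows "x = y \<longleftrightarrow> (\<forall>i\<in>{1..m}. x $ e i = y $ e i)"
proof
  assume eq: "\<forall>i\<in>{1..m}. x $ e i = y $ e i"
  have "x $ k = y $ k" for k
    using eq assms by (metis UNIV_I bij_betw_def imageE)
  then show "x = y"
    by (simp add: vec_eq_iff)
qed simp

lemma foldr_comp_rev_eq_component:
  assumes "\<And>i. i \<in> {2..k} \<Longrightarrow> z i = J i (z (i - 1))" and "1 \<le> k"
  shows "foldr (\<circ>) (map J (rev [2..<Suc k])) id (z 1) = z k"
  using assms(2,1)
proof (induction k rule: dec_induct)
  case (step k)
  then have "z (Suc k) = J (Suc k) (z k)"
    by (metis atLeastAtMost_iff diff_Suc_1 Suc_1 Suc_le_mono le_refl)
  then show ?case
    using step by simp
qed simp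

theorem lemma4p2:
  fixes m :: nat
    and e :: "nat \<Rightarrow> 'n::finite"
    and A :: "nat \<Rightarrow> 'a::{real_inner, complete_space} \<Rightarrow> 'a set"
  assumes "2 \<le> m"
    and "bij_betw e {1..m} UNIV"
    and "\<And>i. i \<in> {1..m} \<Longrightarrow> maximally_monotone (A i)"
  shows "(\<forall>z :: 'a ^ 'n. is_cycle e m A z \<longrightarrow>
            z = product_resolvent e m A (right_shift e m z)) \<and>
         (\<forall>z :: 'a ^ 'n. z = product_resolvent e m A (right_shift e m z) \<longleftrightarrow>
            0 \<in> product_operator e m A z + {z - right_shift e m z})"
proof (intro conjI allI impI)
  fix z :: "'a ^ 'n"
  let ?J = "\<lambda>i. resolvent (A i)"
  have fixed_iff: "z = product_resolvent e m A (right_shift e m z) \<longleftrightarrow>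
      (\<forall>i\<in>{1..m}. z $ e i = ?J i (right_shift e m z $ e i))"
    unfolding vec_eq_iff_enumerated[OF assms(2), of z] product_resolvent_def
    using assms(2) by (simp add: tuple_nth)
  {
    assume cycle: "is_cycle e m A z"
    then have rec: "z $ e i = ?J i (z $ e (i - 1))" if "i \<in> {2..m}" for i
      using that by (simp add: is_cycle_def)
    have "z $ e 1 = ?J 1 (foldr (\<circ>) (map ?J (rev [2..<Suc m])) id (z $ e 1))"
      using cycle by (simp add: is_cycle_def F1_def Fix_def)
    also have "foldr (\<circ>) (map ?J (rev [2..<Suc m])) id (z $ e 1) = z $ e m"
      using foldr_comp_rev_eq_component[of m "\<lambda>i. z $ e i" ?J] rec assms(1) by simp
    finally have first: "z $ e 1 = ?J 1 (z $ e m)" .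
    have "z $ e i = ?J i (right_shift e m z $ e i)" if i: "i \<in> {1..m}" for i
    proof (cases "i = 1")
      case True
      then show ?thesis
        using first i assms(2) by (simp add: right_shift_def tuple_nth)
    next
      case False
      then show ?thesis
        using rec[of i] i assms(2) by (simp add: right_shift_def tuple_nth)
    qed
    then show "z = product_resolvent e m A (right_shift e m z)"
      unfolding fixed_iff by blast
  }
  have "z = product_resolvent e m A (right_shift e m z) \<longleftrightarrow>
      (\<forall>i\<in>{1..m}. right_shift e m z $ e i - z $ e i \<in> A i (z $ e i))"
    unfolding fixed_iff using assms(3) by (simp add: eq_resolvent_iff)
  also have "\<dots> \<longleftrightarrow> right_shift e m z - z \<in> product_operator e m A z"
    by (simp add: product_operator_def)
  also have "\<dots> \<longleftrightarrow> 0 \<in> product_operator e m A z + {z - right_shift e m z}"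
    by (auto simp: set_plus_def eq_neg_iff_add_eq_0[symmetric])
  finally show "z = product_resolvent e m A (right_shift e m z) \<longleftrightarrow>
      0 \<in> product_operator e m A z + {z - right_shift e m z}" .
qed

end
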